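(* Suppose $G$ is a $d$-regular graph of order $p$ and size $q$ with an edge $e$. If $f$ is a local antimagic total labeling of $G$, then $g=p+q+1-f$ is also a local antimagic total labeling of $G$ with $w(g)=w(f)$. Moreover, suppose $w(f)=\chi_{lat}(G)$ and $f(e)=1$ or $f(e)=p+q$. If $\chi(G-e)=\chi_{lat}(G)$, then $\chi_{lat}(G-e)=\chi_{lat}(G)$. Otherwise, $\chi_{lat}(G-e)\le\chi_{lat}(G)$.
   Context: Graphs are finite and simple; $\chi$ is the usual chromatic number. $G-e$ is $G$ with the edge $e$ deleted (keeping all vertices). For a graph $G$ of order $p$ and size $q$, a local antimagic total labeling of $G$ is a bijection $f:V(G)\cup E(G)\to\{1,\ldots,p+q\}$ such that $w_f(u)\neq w_f(v)$ for every edge $uv$ of $G$, where $w_f(u)=f(u)+\sum_{ux\in E(G)}f(ux)$ is the weight of $u$. $w(f)$ denotes the number of distinct vertex weights induced by $f$, and $\chi_{lat}(G)$ is the minimum of $w(f)$ over all local antimagic total labelings $f$ of $G$. The labeling $g=p+q+1-f$ is defined by $g(z)=p+q+1-f(z)$ for all $z\in V(G)\cup E(G)$. *)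

theory Defs
  imports Main "HOL-Library.Extended_Nat"
begin

definition simple_graph :: "'a set \<Rightarrow> 'a set set \<Rightarrow> bool" where
  "simple_graph V E \<longleftrightarrow> finite V \<and> (\<forall>e\<in>E. e \<subseteq> V \<and> card e = 2)"

definition incident_edges :: "'a set set \<Rightarrow> 'a \<Rightarrow> 'a set set" where
  "incident_edges E u = {e \<in> E. u \<in> e}"

definition regular_graph :: "nat \<Rightarrow> 'a set \<Rightarrow> 'a set set \<Rightarrow> bool" where
  "regular_graph d V E \<longleftrightarrow> (\<forall>u\<in>V. card (incident_edges E u) = d)"

definition proper_coloring :: "'a set \<Rightarrow> 'a set set \<Rightarrow> nat \<Rightarrow> ('a \<Rightarrow> nat) \<Rightarrow> bool" where
  "proper_coloring V E k c \<longleftrightarrow>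
     c ` V \<subseteq> {..<k} \<and> (\<forall>u v. {u, v} \<in> E \<longrightarrow> c u \<noteq> c v)"

definition chromatic_number :: "'a set \<Rightarrow> 'a set set \<Rightarrow> nat" where
  "chromatic_number V E = (LEAST k. \<exists>c. proper_coloring V E k c)"

text \<open>
  A total labeling is a function on the disjoint union of vertices and edges: the label of
  a vertex \<open>u\<close> is \<open>f (Inl u)\<close>, that of an edge \<open>e\<close> is \<open>f (Inr e)\<close>. Values outside
  \<open>V <+> E\<close> are irrelevant.
\<close>

type_synonym 'a total_labeling = "'a + 'a set \<Rightarrow> nat"

definition weight :: "'a set set \<Rightarrow> 'a total_labeling \<Rightarrow> 'a \<Rightarrow> nat" where
  "weight E f u = f (Inl u) + (\<Sum>e\<in>incident_edges E u. f (Inr e))"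

definition local_antimagic_total :: "'a set \<Rightarrow> 'a set set \<Rightarrow> 'a total_labeling \<Rightarrow> bool" where
  "local_antimagic_total V E f \<longleftrightarrow>
     bij_betw f (V <+> E) {1..card V + card E} \<and>
     (\<forall>u v. {u, v} \<in> E \<longrightarrow> weight E f u \<noteq> weight E f v)"

definition num_weights :: "'a set \<Rightarrow> 'a set set \<Rightarrow> 'a total_labeling \<Rightarrow> nat" where
  "num_weights V E f = card (weight E f ` V)"

text \<open>
  The infimum is a minimum whenever a local antimagic total labeling exists, and \<open>\<infinity>\<close>
  otherwise; in particular a finite upper bound on it entails that such a labeling exists.
\<close>

definition chi_lat :: "'a set \<Rightarrow> 'a set set \<Rightarrow> enat" where
  "chi_lat V E = (INF f \<in> {f. local_antimagic_total V E f}. enat (num_weights V E f))"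

end

theory Submission
  imports Defs
begin

text \<open>
  In a \<open>d\<close>-regular graph every weight is a sum of exactly \<open>d + 1\<close> labels, so an affine
  change of all labels acts on all weights by one and the same injective affine map; it
  therefore preserves both the inequalities along edges and the number of distinct weights.

  Two changes are used. Reflecting the labels, \<open>x \<mapsto> p + q + 1 - x\<close>, yields the claim
  about \<open>g\<close>. Shifting the labels down by one gives the edge labeled \<open>1\<close> the label \<open>0\<close>, so
  that deleting this edge changes no weight, while the remaining elements of \<open>G - e\<close> receive
  exactly the labels \<open>1, \<dots>, p + q - 1\<close> (lemma \<open>delete_edge_labeled_one\<close>). An optimal
  labeling with \<open>f e = 1\<close> thus bounds \<open>\<chi>\<^sub>l\<^sub>a\<^sub>t(G - e)\<close> from above by \<open>\<chi>\<^sub>l\<^sub>a\<^sub>t(G)\<close>; if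
  \<open>f e = p + q\<close>, the same holds for its reflection, which is optimal as well. Finally, the
  weights of a local antimagic total labeling are a proper coloring, so that
  \<open>\<chi>(G - e) \<le> \<chi>\<^sub>l\<^sub>a\<^sub>t(G - e)\<close>, and the two bounds meet if \<open>\<chi>(G - e) = \<chi>\<^sub>l\<^sub>a\<^sub>t(G)\<close>.
\<close>

lemma simple_graph_finite_edges:
  assumes "simple_graph V E"
  shows "finite E"
proof (rule finite_subset)
  show "E \<subseteq> Pow V" "finite (Pow V)"
    using assms by (auto simp: simple_graph_def)
qed

lemma simple_graph_edge_vertices:
  assumes "simple_graph V E" "{u, v} \<in> E"
  shows "u \<in> V" "v \<in> V"
  using assms unfolding simple_graph_def by blast+

lemma label_bounds:
  assumes "local_antimagic_total V E f" "z \<in> V <+> E"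
  shows "1 \<le> f z" "f z \<le> card V + card E"
proof -
  have "f z \<in> {1..card V + card E}"
    using assms unfolding local_antimagic_total_def by (blast dest: bij_betwE)
  then show "1 \<le> f z" "f z \<le> card V + card E"
    by simp_all
qed

lemma chi_lat_le:
  assumes "local_antimagic_total V E f"
  shows "chi_lat V E \<le> enat (num_weights V E f)"
  unfolding chi_lat_def using assms by (intro INF_lower) simp

lemma num_weights_comp_inj:
  assumes "\<And>u. u \<in> V \<Longrightarrow> weight E' f' u = \<phi> (weight E f u)"
    and "inj_on \<phi> (weight E f ` V)"
  shows "num_weights V E' f' = num_weights V E f"
proof -
  have "weight E' f' ` V = \<phi> ` weight E f ` V"
    using assms(1) by (auto simp: image_iff)
  then show ?thesis
    by (simp add: num_weights_def card_image[OF assms(2)])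
qed

lemma weight_reflect:
  assumes "regular_graph d V E" "local_antimagic_total V E f" "u \<in> V"
  shows "weight E (\<lambda>z. card V + card E + 1 - f z) u + weight E f u
    = (d + 1) * (card V + card E + 1)"
proof -
  define N where "N = card V + card E + 1"
  let ?I = "incident_edges E u"
  have le: "f z \<le> N" if "z \<in> V <+> E" for z
    using label_bounds(2)[OF assms(2) that] by (simp add: N_def)
  have "(\<Sum>x\<in>?I. N - f (Inr x)) + (\<Sum>x\<in>?I. f (Inr x)) = (\<Sum>x\<in>?I. N)"
    unfolding sum.distrib[symmetric]
    by (rule sum.cong) (use le in \<open>auto simp: incident_edges_def intro!: le_add_diff_inverse2\<close>)
  also have "\<dots> = d * N"
    using assms(1,3) by (simp add: regular_graph_def)
  finally have "(\<Sum>x\<in>?I. N - f (Inr x)) + (\<Sum>x\<in>?I. f (Inr x)) = d * N" .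
  moreover have "N - f (Inl u) + f (Inl u) = N"
    using le[of "Inl u"] assms(3) by (auto intro!: le_add_diff_inverse2)
  ultimately show ?thesis
    unfolding weight_def N_def[symmetric] by simp
qed

lemma local_antimagic_total_reflect:
  assumes "simple_graph V E" "regular_graph d V E" "local_antimagic_total V E f"
  defines "g \<equiv> \<lambda>z. card V + card E + 1 - f z"
  shows "local_antimagic_total V E g" "num_weights V E g = num_weights V E f"
proof -
  let ?N = "card V + card E + 1"
  have weight_g: "weight E g u + weight E f u = (d + 1) * ?N" if "u \<in> V" for u
    unfolding g_def using weight_reflect[OF assms(2,3) that] .
  have "bij_betw (\<lambda>x. ?N - x) {1..card V + card E} {1..card V + card E}"
    by (rule bij_betw_byWitness[where f' = "\<lambda>x. ?N - x"]) auto
  then have "bij_betw g (V <+> E) {1..card V + card E}"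
    using bij_betw_trans[of f "V <+> E" "{1..card V + card E}" "\<lambda>x. ?N - x"] assms(3)
    unfolding g_def local_antimagic_total_def comp_def by blast
  moreover have "weight E g u \<noteq> weight E g v" if "{u, v} \<in> E" for u v
  proof -
    have "weight E f u \<noteq> weight E f v"
      using assms(3) that by (simp add: local_antimagic_total_def)
    then show ?thesis
      using weight_g[of u] weight_g[of v] simple_graph_edge_vertices[OF assms(1) that]
      by linarith
  qed
  ultimately show "local_antimagic_total V E g"
    by (simp add: local_antimagic_total_def)
  show "num_weights V E g = num_weights V E f"
  proof (rule num_weights_comp_inj)
    show "weight E g u = (d + 1) * ?N - weight E f u" if "u \<in> V" for u
      using weight_g[OF that] by linarith
    \<comment> \<open>The truncated subtraction is injective because no weight exceeds \<open>(d + 1) * ?N\<close>.\<close>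
    have "weight E f u \<le> (d + 1) * ?N" if "u \<in> V" for u
      using weight_g[OF that] by linarith
    then show "inj_on (\<lambda>w. (d + 1) * ?N - w) (weight E f ` V)"
      by (intro inj_onI) (metis (no_types, lifting) diff_diff_cancel imageE)
  qed
qed

text \<open>
  The ends of \<open>e\<close> lose the label \<open>1\<close> of \<open>e\<close> and one for each of their \<open>d\<close> other labels; every
  other vertex loses one for each of its \<open>d + 1\<close> labels.
\<close>
lemma weight_delete_edge_labeled_one:
  assumes "simple_graph V E" "regular_graph d V E" "local_antimagic_total V E f"
    and "f (Inr e) = 1" "u \<in> V"
  shows "weight (E - {e}) (\<lambda>z. f z - 1) u + (d + 1) = weight E f u"
proof -
  let ?I = "incident_edges E u"
  have pos: "1 \<le> f z" if "z \<in> V <+> E" for z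
    using label_bounds(1)[OF assms(3) that] .
  have "finite ?I"
    using simple_graph_finite_edges[OF assms(1)] by (simp add: incident_edges_def)
  \<comment> \<open>If \<open>u \<in> e\<close>, the extra term on the right belongs to \<open>e\<close> and is \<open>1 - 1 = 0\<close>.\<close>
  then have "(\<Sum>x\<in>incident_edges (E - {e}) u. f (Inr x) - 1) = (\<Sum>x\<in>?I. f (Inr x) - 1)"
    by (intro sum.mono_neutral_left) (auto simp: incident_edges_def assms(4))
  moreover have "(\<Sum>x\<in>?I. f (Inr x) - 1) + (\<Sum>x\<in>?I. 1) = (\<Sum>x\<in>?I. f (Inr x))"
    unfolding sum.distrib[symmetric]
    by (rule sum.cong) (auto simp: incident_edges_def simp del: One_nat_def
      intro!: le_add_diff_inverse2 pos)
  moreover have "(\<Sum>x\<in>?I. 1) = d"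
    using assms(2,5) by (simp add: regular_graph_def)
  moreover have "f (Inl u) - 1 + 1 = f (Inl u)"
    using assms(5) by (intro le_add_diff_inverse2 pos) auto
  ultimately show ?thesis
    unfolding weight_def by linarith
qed

lemma delete_edge_labeled_one:
  assumes "simple_graph V E" "regular_graph d V E" "local_antimagic_total V E f"
    and "e \<in> E" "f (Inr e) = 1"
  defines "h \<equiv> \<lambda>z. f z - 1"
  shows "local_antimagic_total V (E - {e}) h"
    and "num_weights V (E - {e}) h = num_weights V E f"
proof -
  let ?n = "card V + card E"
  have weight_h: "weight (E - {e}) h u + (d + 1) = weight E f u" if "u \<in> V" for u
    unfolding h_def using weight_delete_edge_labeled_one[OF assms(1-3,5) that] .
  have "finite E"
    using simple_graph_finite_edges[OF assms(1)] .
  then have "0 < card E" "card (E - {e}) = card E - 1"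
    using assms(4) by (auto simp: card_gt_0_iff)
  then have card: "card V + card (E - {e}) = ?n - 1"
    by simp
  have "bij_betw f (V <+> E) {1..?n}"
    using assms(3) by (simp add: local_antimagic_total_def)
  then have "bij_betw f (V <+> E - {Inr e}) ({1..?n} - {1})"
    using assms(4,5) \<open>0 < card E\<close> by (intro bij_betw_DiffI) (auto simp: bij_betw_def)
  moreover have "V <+> E - {Inr e} = V <+> (E - {e})"
    by auto
  moreover have "bij_betw (\<lambda>x. x - 1) ({1..?n} - {1}) {1..?n - 1}"
    by (rule bij_betw_byWitness[where f' = Suc]) auto
  ultimately have "bij_betw h (V <+> (E - {e})) {1..card V + card (E - {e})}"
    unfolding h_def card by (auto dest: bij_betw_trans simp: comp_def)
  moreover have "weight (E - {e}) h u \<noteq> weight (E - {e}) h v" if "{u, v} \<in> E - {e}" for u v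
  proof -
    have "{u, v} \<in> E"
      using that by simp
    then have "weight E f u \<noteq> weight E f v"
      using assms(3) by (simp add: local_antimagic_total_def)
    then show ?thesis
      using weight_h[of u] weight_h[of v] simple_graph_edge_vertices[OF assms(1) \<open>{u, v} \<in> E\<close>]
      by linarith
  qed
  ultimately show "local_antimagic_total V (E - {e}) h"
    by (simp add: local_antimagic_total_def)
  have "num_weights V E f = num_weights V (E - {e}) h"
    by (rule num_weights_comp_inj[where \<phi> = "\<lambda>w. w + (d + 1)"])
      (simp_all only: weight_h inj_on_add')
  then show "num_weights V (E - {e}) h = num_weights V E f" ..
qed

text \<open>Numbering the distinct weights turns the weight function into a proper coloring.\<close>
lemma chromatic_number_le_chi_lat:
  assumes "simple_graph V E"
  shows "enat (chromatic_number V E) \<le> chi_lat V E"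
  unfolding chi_lat_def
proof (rule INF_greatest)
  fix f assume "f \<in> {f. local_antimagic_total V E f}"
  then have f: "local_antimagic_total V E f"
    by simp
  let ?W = "weight E f ` V"
  have "finite ?W"
    using assms by (simp add: simple_graph_def)
  then obtain \<nu> where \<nu>: "bij_betw \<nu> ?W {0..<card ?W}"
    using ex_bij_betw_finite_nat by blast
  have "\<nu> (weight E f u) \<noteq> \<nu> (weight E f v)" if "{u, v} \<in> E" for u v
  proof -
    have "weight E f u \<noteq> weight E f v"
      using f that by (simp add: local_antimagic_total_def)
    then show ?thesis
      using bij_betw_imp_inj_on[OF \<nu>] simple_graph_edge_vertices[OF assms that]
      by (auto dest: inj_onD)
  qed
  moreover have "(\<lambda>u. \<nu> (weight E f u)) ` V \<subseteq> {..<card ?W}"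
    using bij_betwE[OF \<nu>] by auto
  ultimately have "proper_coloring V E (card ?W) (\<lambda>u. \<nu> (weight E f u))"
    by (simp add: proper_coloring_def)
  then have "chromatic_number V E \<le> num_weights V E f"
    unfolding chromatic_number_def num_weights_def by (blast intro: Least_le)
  then show "enat (chromatic_number V E) \<le> enat (num_weights V E f)"
    by simp
qed

theorem lemma2p11:
  fixes V :: "'a set" and E :: "'a set set" and e :: "'a set"
    and d p q :: nat and f g :: "'a total_labeling"
  assumes "simple_graph V E"
    and "regular_graph d V E"
    and "p = card V"
    and "q = card E"
    and "e \<in> E"
    and "local_antimagic_total V E f"
    and "g = (\<lambda>z. p + q + 1 - f z)"
  shows "local_antimagic_total V E g \<and> num_weights V E g = num_weights V E f \<and>
    (enat (num_weights V E f) = chi_lat V E \<and> (f (Inr e) = 1 \<or> f (Inr e) = p + q) \<longrightarrow>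
      (if enat (chromatic_number V (E - {e})) = chi_lat V E
       then chi_lat V (E - {e}) = chi_lat V E
       else chi_lat V (E - {e}) \<le> chi_lat V E))"
proof -
  have g: "local_antimagic_total V E g" "num_weights V E g = num_weights V E f"
    using local_antimagic_total_reflect[OF assms(1,2,6)] by (simp_all add: assms(3,4,7))
  have upper: "chi_lat V (E - {e}) \<le> chi_lat V E"
    if opt: "enat (num_weights V E f) = chi_lat V E"
      and ext: "f (Inr e) = 1 \<or> f (Inr e) = p + q"
  proof -
    obtain f' where f': "local_antimagic_total V E f'" "f' (Inr e) = 1"
      "num_weights V E f' = num_weights V E f"
    proof (cases "f (Inr e) = 1")
      case True
      then show ?thesis
        using that[of f] assms(6) by simp
    next
      case False
      then have "g (Inr e) = 1"
        using ext by (simp add: assms(7))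
      then show ?thesis
        using that[of g] g by simp
    qed
    show ?thesis
      using chi_lat_le[OF delete_edge_labeled_one(1)[OF assms(1,2) f'(1) assms(5) f'(2)]]
        delete_edge_labeled_one(2)[OF assms(1,2) f'(1) assms(5) f'(2)] f'(3) opt
      by simp
  qed
  have "simple_graph V (E - {e})"
    using assms(1) by (simp add: simple_graph_def)
  then have lower: "enat (chromatic_number V (E - {e})) \<le> chi_lat V (E - {e})"
    by (rule chromatic_number_le_chi_lat)
  show ?thesis
    using g upper lower by (auto intro: antisym)
qed

end
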